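(* There exist a sequence $(X_n)_{n=1}^\infty$ of Lindelöf spaces $X_n$ and a function $f:\prod_{n=1}^\infty X_n\to\mathbb R$ of the first Baire class such that: (i) for every $n\in\mathbb N$ the product $Y_n=\prod_{k=1}^n X_k$ is Lindelöf; (ii) $f$ is not the pointwise limit of any sequence $(f_n)_{n=1}^\infty$ of functions from ${\rm CF}(\prod_{n=1}^\infty X_n)$.
   Context: A real function on a topological space is of the first Baire class if it is the pointwise limit of a sequence of continuous real functions. For a product $P=\prod_{n=1}^\infty X_n$, a function $f:P\to\mathbb R$ is finitely determined (depends on finitely many coordinates) if there is $n\in\mathbb N$ such that $f(x)=f(y)$ for all $x,y\in P$ with $x_i=y_i$ for $i=1,\dots,n$. ${\rm CF}(P)$ denotes the set of all continuous finitely determined functions $P\to\mathbb R$. *)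

theory Defs
  imports "HOL-Analysis.Analysis"
begin

text \<open>
  Functions on a topological space are represented by total HOL functions; only their values on
  the \<^const>\<open>topspace\<close> matter in the definitions below.
\<close>

definition pointwise_limit :: "'a topology \<Rightarrow> (nat \<Rightarrow> 'a \<Rightarrow> real) \<Rightarrow> ('a \<Rightarrow> real) \<Rightarrow> bool"
  where "pointwise_limit T g f \<longleftrightarrow> (\<forall>x\<in>topspace T. (\<lambda>n. g n x) \<longlonglongrightarrow> f x)"

definition baire_one :: "'a topology \<Rightarrow> ('a \<Rightarrow> real) \<Rightarrow> bool"
  where "baire_one T f \<longleftrightarrow>
    (\<exists>g. (\<forall>n. continuous_map T euclideanreal (g n)) \<and> pointwise_limit T g f)"

text \<open>Coordinates are indexed by the positive natural numbers; \<open>X 0\<close> is not used.\<close>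

abbreviation seq_product :: "(nat \<Rightarrow> 'a topology) \<Rightarrow> (nat \<Rightarrow> 'a) topology"
  where "seq_product X \<equiv> product_topology X {1..}"

definition finitely_determined :: "(nat \<Rightarrow> 'a topology) \<Rightarrow> ((nat \<Rightarrow> 'a) \<Rightarrow> real) \<Rightarrow> bool"
  where "finitely_determined X f \<longleftrightarrow>
    (\<exists>n\<ge>1. \<forall>x\<in>topspace (seq_product X). \<forall>y\<in>topspace (seq_product X).
       (\<forall>i\<in>{1..n}. x i = y i) \<longrightarrow> f x = f y)"

definition CF :: "(nat \<Rightarrow> 'a topology) \<Rightarrow> ((nat \<Rightarrow> 'a) \<Rightarrow> real) set"
  where "CF X = {f. continuous_map (seq_product X) euclideanreal f \<and> finitely_determined X f}"

end

theory Submission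
  imports Defs
begin

text \<open>
  A bijection of \<open>\<real>\<close> with the subsets of \<open>\<nat>\<close> makes \<open>\<real>\<close> a Cantor space. By a Bernstein-type
  transfinite construction there is a rank function \<open>r\<close> on \<open>\<real>\<close> such that every closed subset of a
  finite power that is not covered by countably many hyperplanes \<open>x\<^sub>i = c\<close> contains, for each \<open>n\<close>, a
  point all of whose coordinates have rank \<open>n\<close>. In the Michael-line topology \<open>X\<^sub>n\<close> the points of
  rank below \<open>n\<close> are isolated and the others keep their Cantor neighbourhoods. Finite products of
  these spaces are Lindelof: countably many basic boxes cover everything outside a closed set
  without points all of whose coordinates have rank \<open>n\<close>, and that set lies in countably many
  hyperplanes, which are handled by induction.

  Every point \<open>t\<close> is isolated in almost all \<open>X\<^sub>n\<close>, so the diagonal is discrete in the infinite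
  product, and any closed subset of the Cantor space, placed on the diagonal, is the trace of a
  clopen set. Hence the characteristic function of
  \<open>E = {t. t has only finitely many even elements}\<close> on the diagonal extends to a function of the
  first class. A continuous finitely determined function restricts on the diagonal to a continuous
  function on some \<open>X\<^sub>n\<close>, which is Cantor-continuous off a countable set. Since \<open>E\<close> and its
  complement stay dense after the removal of any countable set, such functions cannot converge to
  the characteristic function of \<open>E\<close>.
\<close>

unbundle cardinal_syntax

section \<open>Transfinite selection\<close>

text \<open>Transfinite recursion along the cardinal well-order of \<open>T\<close>. Its proper
  initial segments have smaller cardinality than the type \<open>'b\<close>, and the sets
  \<open>K j (c j)\<close> are finite, so fewer points are used up than there are candidates
  \<open>b\<close>. By disjointness each used point spoils at most one candidate.\<close>

lemma disjoint_selection: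
  fixes K :: "'i \<Rightarrow> 'b \<Rightarrow> 'a set"
  assumes inf: "infinite (UNIV :: 'b set)" and T: "T \<lesssim> (UNIV :: 'b set)"
    and fin: "\<And>i b. i \<in> T \<Longrightarrow> finite (K i b)"
    and disj: "\<And>i b b'. i \<in> T \<Longrightarrow> b \<noteq> b' \<Longrightarrow> K i b \<inter> K i b' = {}"
  shows "\<exists>c. \<forall>i\<in>T. \<forall>j\<in>T. i \<noteq> j \<longrightarrow> K i (c i) \<inter> K j (c j) = {}"
proof -
  let ?r = "|T|"
  let ?R = "?r - Id"
  have wo: "Well_order ?r"
    by (rule card_of_Well_order)
  then have wf: "wf ?R"
    by (simp add: well_order_on_def)
  have exb: "\<exists>b. \<forall>j. (j, i) \<in> ?R \<longrightarrow> K i b \<inter> K j (c j) = {}" if "i \<in> T" for i c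
  proof (rule ccontr)
    define J where "J = underS ?r i"
    define D where "D = (\<Union>j\<in>J. K j (c j))"
    assume "\<not> ?thesis"
    then have "\<forall>b. \<exists>a. a \<in> K i b \<and> (\<exists>j. (j, i) \<in> ?R \<and> a \<in> K j (c j))"
      by blast
    then obtain g where g: "\<And>b. g b \<in> K i b" "\<And>b. \<exists>j. (j, i) \<in> ?R \<and> g b \<in> K j (c j)"
      by metis
    have "inj g"
      using disj[OF that] g(1) by (metis IntI empty_iff injI)
    moreover have "range g \<subseteq> D"
      using g(2) by (fastforce simp: D_def J_def underS_def)
    ultimately have D: "|UNIV :: 'b set| \<le>o |D|"
      using card_of_ordLeq by blast
    have JT: "J \<subseteq> T"
      unfolding J_def underS_def by (auto dest: FieldI1 simp: Field_card_of)
    have "|J| <o |T|"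
      unfolding J_def using card_of_underS[OF card_of_Card_order] that by (simp add: Field_card_of)
    moreover have "|T| \<le>o |UNIV :: 'b set|"
      using T card_of_ordLeq unfolding lepoll_def by blast
    ultimately have J: "|J| <o |UNIV :: 'b set|"
      using ordLess_ordLeq_trans by blast
    have finK: "finite (K j (c j))" if "j \<in> J" for j
      using fin JT that by blast
    show False
    proof (cases "finite J")
      case True
      then have "finite D"
        using finK by (auto simp: D_def)
      with D inf show False
        using card_of_ordLeq_finite by blast
    next
      case False
      have "|D| \<le>o |J|"
        unfolding D_def
      proof (rule card_of_UNION_ordLeq_infinite[OF False])
        show "\<forall>j\<in>J. |K j (c j)| \<le>o |J|"
          using finite_ordLess_infinite[OF card_of_Well_order card_of_Well_order] finK False
          by (auto intro: ordLess_imp_ordLeq simp: Field_card_of)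
      qed (rule ordLeq_refl[OF card_of_Card_order])
      with D J show False
        using not_ordLess_ordLeq ordLeq_transitive by blast
    qed
  qed
  have "\<exists>c. \<forall>i. i \<in> T \<longrightarrow> (\<forall>j. (j, i) \<in> ?R \<longrightarrow> K i (c i) \<inter> K j (c j) = {})"
    by (rule dependent_wf_choice[OF wf,
          where P = "\<lambda>c i b. i \<in> T \<longrightarrow> (\<forall>j. (j, i) \<in> ?R \<longrightarrow> K i b \<inter> K j (c j) = {})"])
      (use exb in \<open>auto\<close>)
  then obtain c where c: "\<And>i j. i \<in> T \<Longrightarrow> (j, i) \<in> ?R \<Longrightarrow> K i (c i) \<inter> K j (c j) = {}"
    by blast
  show ?thesis
  proof (intro exI ballI impI)
    fix i j assume "i \<in> T" "j \<in> T" "i \<noteq> j"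
    moreover have "total_on T ?r"
      using wo by (simp add: well_order_on_def linear_order_on_def Field_card_of)
    ultimately have "(i, j) \<in> ?R \<or> (j, i) \<in> ?R"
      by (auto simp: total_on_def)
    then show "K i (c i) \<inter> K j (c j) = {}"
      using c \<open>i \<in> T\<close> \<open>j \<in> T\<close> by blast
  qed
qed

section \<open>The Cantor space structure on the reals\<close>

text \<open>An arbitrary bijection suffices: it transports the Cantor space of subsets of the
  naturals to \<open>real\<close>, and avoids the ambiguities of digit expansions.\<close>

definition digits :: "real \<Rightarrow> nat set"
  where "digits = (SOME d. bij d)"

lemma bij_digits: "bij digits"
proof -
  have "\<exists>d :: real \<Rightarrow> nat set. bij d"
    using eqpoll_sym[OF nat_sets_eqpoll_reals] by (simp add: eqpoll_def)
  then show ?thesis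
    unfolding digits_def by (rule someI_ex)
qed

lemma obtain_digits:
  obtains x where "digits x = A"
  using surjD[OF bij_is_surj[OF bij_digits], of A] by auto

text \<open>The sets \<open>{y. agree k x y}\<close> are the basic clopen cylinders of the Cantor
  topology.\<close>

definition agree :: "nat \<Rightarrow> real \<Rightarrow> real \<Rightarrow> bool"
  where "agree k x y \<longleftrightarrow> (\<forall>j<k. j \<in> digits x \<longleftrightarrow> j \<in> digits y)"

lemma agree_refl [simp]: "agree k x x"
  by (simp add: agree_def)

lemma agree_trans: "agree k x y \<Longrightarrow> agree k y z \<Longrightarrow> agree k x z"
  by (simp add: agree_def)

lemma agree_mono: "agree k x y \<Longrightarrow> l \<le> k \<Longrightarrow> agree l x y"
  by (simp add: agree_def)

lemma agree_all_imp_eq: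
  assumes "\<And>k. agree k x y"
  shows "x = y"
proof -
  have "digits x = digits y"
  proof (rule set_eqI)
    fix j show "j \<in> digits x \<longleftrightarrow> j \<in> digits y"
      using assms[of "Suc j"] by (simp add: agree_def)
  qed
  then show ?thesis
    by (rule injD[OF bij_is_inj[OF bij_digits]])
qed

lemma not_agree_eventually: "x \<noteq> y \<Longrightarrow> \<exists>k0. \<forall>k\<ge>k0. \<not> agree k x y"
  by (metis agree_all_imp_eq agree_mono)

text \<open>Completeness of the Cantor space: depths increase strictly, so digit \<open>j\<close> no
  longer changes from stage \<open>Suc j\<close> on, and the limit reads it off there.\<close>

lemma agree_limit:
  assumes "\<And>n. agree (d n) (p n) (p (Suc n))" "strict_mono d"
  obtains x where "\<And>n. agree (d n) (p n) x"
proof -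
  have later: "agree (d n) (p n) (p m)" if "n \<le> m" for n m
    using that
  proof (induction m rule: dec_induct)
    case (step m)
    have "d n \<le> d m"
      using assms(2) step(1) by (simp add: strict_mono_less_eq)
    then have "agree (d n) (p m) (p (Suc m))"
      by (rule agree_mono[OF assms(1)])
    then show ?case
      by (rule agree_trans[OF step.IH])
  qed simp
  obtain x where x: "digits x = {j. j \<in> digits (p (Suc j))}"
    by (rule obtain_digits)
  show thesis
  proof (rule that)
    fix n
    show "agree (d n) (p n) x"
      unfolding agree_def
    proof (intro allI impI)
      fix j assume j: "j < d n"
      have "j < d (Suc j)"
        using strict_mono_imp_increasing[OF assms(2), of "Suc j"] by simp
      moreover have "agree (d n) (p n) (p (Suc j)) \<or> agree (d (Suc j)) (p (Suc j)) (p n)"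
        using later linear[of n "Suc j"] by blast
      ultimately have "j \<in> digits (p n) \<longleftrightarrow> j \<in> digits (p (Suc j))"
        using j unfolding agree_def by blast
      then show "j \<in> digits (p n) \<longleftrightarrow> j \<in> digits x"
        by (simp add: x)
    qed
  qed
qed

section \<open>Cylinder boxes in powers of the Cantor space\<close>

definition agree_on :: "nat set \<Rightarrow> nat \<Rightarrow> (nat \<Rightarrow> real) \<Rightarrow> (nat \<Rightarrow> real) \<Rightarrow> bool"
  where "agree_on I k x y \<longleftrightarrow> (\<forall>i\<in>I. agree k (x i) (y i))"

lemma agree_on_refl [simp]: "agree_on I k x x"
  by (simp add: agree_on_def)

lemma agree_on_sym: "agree_on I k x y \<Longrightarrow> agree_on I k y x"
  by (simp add: agree_on_def agree_def)

lemma agree_on_mono: "agree_on I k x y \<Longrightarrow> l \<le> k \<Longrightarrow> agree_on I l x y"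
  by (simp add: agree_on_def agree_def)

abbreviation cube :: "nat set \<Rightarrow> (nat \<Rightarrow> real) set"
  where "cube I \<equiv> PiE I (\<lambda>_. UNIV)"

definition cyl_box :: "nat set \<Rightarrow> nat \<Rightarrow> (nat \<Rightarrow> real) \<Rightarrow> (nat \<Rightarrow> real) set"
  where "cyl_box I k x = {y \<in> cube I. agree_on I k x y}"

lemma cyl_box_eqI: "agree_on I k x y \<Longrightarrow> cyl_box I k x = cyl_box I k y"
  by (auto simp: cyl_box_def agree_on_def agree_def)

text \<open>A box of depth \<open>k\<close> depends only on the first \<open>k\<close> digits of the
  coordinates in \<open>I\<close>; for finite \<open>I\<close> there are finitely many such
  patterns.\<close>

lemma countable_boxes:
  assumes "finite I"
  shows "countable (\<Union>k. range (cyl_box I k))"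
proof -
  have "countable (range (cyl_box I k))" for k
  proof -
    let ?p = "\<lambda>x. \<lambda>i\<in>I. digits (x i) \<inter> {..<k}"
    have eq: "cyl_box I k x = cyl_box I k y" if that': "?p x = ?p y" for x y
    proof (rule cyl_box_eqI)
      have "digits (x i) \<inter> {..<k} = digits (y i) \<inter> {..<k}" if "i \<in> I" for i
        using fun_cong[OF that', of i] that by simp
      then show "agree_on I k x y"
        by (force simp: agree_on_def agree_def)
    qed
    have "range ?p \<subseteq> PiE I (\<lambda>_. Pow {..<k})"
      by auto
    then have fin: "finite (range ?p)"
      by (rule finite_subset) (simp add: assms finite_PiE)
    have "range (cyl_box I k) \<subseteq> (\<lambda>q. cyl_box I k (SOME x. ?p x = q)) ` range ?p"
    proof clarify
      fix x
      have "?p (SOME z. ?p z = ?p x) = ?p x"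
        by (rule someI[where P = "\<lambda>z. ?p z = ?p x"]) (rule refl)
      then have "cyl_box I k x = cyl_box I k (SOME z. ?p z = ?p x)"
        by (intro eq) (rule sym)
      then show "cyl_box I k x \<in> (\<lambda>q. cyl_box I k (SOME x. ?p x = q)) ` range ?p"
        by (rule image_eqI[where x = "?p x"]) (rule rangeI)
    qed
    then show ?thesis
      by (rule countable_finite[OF finite_subset[OF _ finite_imageI[OF fin]]])
  qed
  then show ?thesis
    by blast
qed

section \<open>Closed sets that are not covered by countably many hyperplanes\<close>

text \<open>For finite \<open>I\<close> this is closedness in the power of the Cantor space, because
  boxes with one common depth form a neighbourhood base.\<close>

definition cantor_closed :: "nat set \<Rightarrow> (nat \<Rightarrow> real) set \<Rightarrow> bool"
  where "cantor_closed I F \<longleftrightarrow>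
    F \<subseteq> cube I \<and> (\<forall>x\<in>cube I. (\<forall>k. \<exists>y\<in>F. agree_on I k x y) \<longrightarrow> x \<in> F)"

text \<open>Coverability by countably many hyperplanes \<open>x i = c\<close>. For a one-element
  \<open>I\<close> and subsets of \<open>cube I\<close> this is countability.\<close>

definition thin :: "nat set \<Rightarrow> (nat \<Rightarrow> real) set \<Rightarrow> bool"
  where "thin I F \<longleftrightarrow> (\<exists>C. countable C \<and> (\<forall>x\<in>F. \<exists>i\<in>I. x i \<in> C))"

lemma thin_subset: "thin I G \<Longrightarrow> F \<subseteq> G \<Longrightarrow> thin I F"
  unfolding thin_def by blast

lemma thin_Union:
  assumes "countable \<F>" "\<And>F. F \<in> \<F> \<Longrightarrow> thin I F"
  shows "thin I (\<Union>\<F>)"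
proof -
  obtain C where C: "\<And>F. F \<in> \<F> \<Longrightarrow> countable (C F) \<and> (\<forall>x\<in>F. \<exists>i\<in>I. x i \<in> C F)"
    using assms(2) unfolding thin_def by metis
  have "countable (\<Union>F\<in>\<F>. C F)"
    using C assms(1) by blast
  moreover have "\<forall>x\<in>\<Union>\<F>. \<exists>i\<in>I. x i \<in> (\<Union>F\<in>\<F>. C F)"
    using C by blast
  ultimately show ?thesis
    unfolding thin_def by blast
qed

lemma thin_Un: "thin I F \<Longrightarrow> thin I G \<Longrightarrow> thin I (F \<union> G)"
  using thin_Union[of "{F, G}" I] by auto

text \<open>An analogue of the perfect kernel, with thin sets in the role of countable sets.\<close>

definition thick_part :: "nat set \<Rightarrow> (nat \<Rightarrow> real) set \<Rightarrow> (nat \<Rightarrow> real) set"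
  where "thick_part I F = {x \<in> F. \<forall>k. \<not> thin I (F \<inter> cyl_box I k x)}"

text \<open>As for Cantor-Bendixson: every removed point lies in one of the countably many boxes on
  which \<open>F\<close> is thin.\<close>

lemma thin_minus_thick_part:
  assumes "finite I" "F \<subseteq> cube I"
  shows "thin I (F - thick_part I F)"
proof -
  let ?B = "{b \<in> (\<Union>k. range (cyl_box I k)). thin I (F \<inter> b)}"
  have "countable ((\<inter>) F ` ?B)"
    by (intro countable_image countable_subset[OF _ countable_boxes[OF assms(1)]]) blast
  then have "thin I (\<Union>((\<inter>) F ` ?B))"
    by (rule thin_Union) blast
  moreover have "F - thick_part I F \<subseteq> \<Union>((\<inter>) F ` ?B)"
  proof
    fix x assume x: "x \<in> F - thick_part I F"
    then obtain k where "thin I (F \<inter> cyl_box I k x)"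
      by (auto simp: thick_part_def)
    then have "cyl_box I k x \<in> ?B"
      by blast
    moreover have "x \<in> F \<inter> cyl_box I k x"
      using x assms(2) by (auto simp: cyl_box_def)
    ultimately show "x \<in> \<Union>((\<inter>) F ` ?B)"
      by (rule UnionI[OF imageI])
  qed
  ultimately show ?thesis
    by (rule thin_subset)
qed

text \<open>Otherwise \<open>C\<close> would witness that the thick part is thin inside the box;
  adding the thin remainder of \<open>F\<close> would contradict the thickness at
  \<open>x\<close>.\<close>

lemma thick_part_meets_box:
  assumes "finite I" "F \<subseteq> cube I" "x \<in> thick_part I F" "countable C"
  obtains y where "y \<in> thick_part I F" "agree_on I k x y" "\<And>i. i \<in> I \<Longrightarrow> y i \<notin> C"
proof (rule ccontr)
  assume *: "\<not> thesis"
  have "thin I (thick_part I F \<inter> cyl_box I k x)"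
    unfolding thin_def using assms(4) that * by (intro exI[of _ C]) (auto simp: cyl_box_def)
  then have "thin I ((F - thick_part I F) \<union> (thick_part I F \<inter> cyl_box I k x))"
    by (rule thin_Un[OF thin_minus_thick_part[OF assms(1,2)]])
  then have "thin I (F \<inter> cyl_box I k x)"
    by (rule thin_subset) blast
  with assms(3) show False
    by (simp add: thick_part_def)
qed

text \<open>Choose \<open>y\<close> off the finitely many values of \<open>x\<close>, then go deep
  enough to separate every \<open>x i\<close> from every \<open>y j\<close>. The pairs with
  different indices matter too, since ranks will be assigned to values regardless of the
  coordinate.\<close>

lemma thick_part_split:
  assumes "finite I" "F \<subseteq> cube I" "x \<in> thick_part I F"
  obtains y l where "y \<in> thick_part I F" "agree_on I k x y" "k < l"
    "\<And>z w i j. agree_on I l x z \<Longrightarrow> agree_on I l y w \<Longrightarrow> i \<in> I \<Longrightarrow> j \<in> I \<Longrightarrow> z i \<noteq> w j"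
proof -
  have "countable (x ` I)"
    using assms(1) by (simp add: countable_finite)
  then obtain y where y: "y \<in> thick_part I F" "agree_on I k x y" "\<And>i. i \<in> I \<Longrightarrow> y i \<notin> x ` I"
    using thick_part_meets_box[OF assms, of "x ` I" k] by blast
  have "\<exists>l. \<forall>m\<ge>l. \<not> agree m (x i) (y j)" if "i \<in> I" "j \<in> I" for i j
    by (rule not_agree_eventually) (use y(3)[OF that(2)] that(1) in force)
  then have "\<exists>l. i \<in> I \<longrightarrow> j \<in> I \<longrightarrow> (\<forall>m\<ge>l. \<not> agree m (x i) (y j))" for i j
    by blast
  then obtain L where L: "\<And>i j m. i \<in> I \<Longrightarrow> j \<in> I \<Longrightarrow> L i j \<le> m \<Longrightarrow> \<not> agree m (x i) (y j)"
    by metis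
  \<comment> \<open>The sum bounds all separation depths at once, and \<open>Suc k\<close> forces
    \<open>k < l\<close>.\<close>
  define l where "l = Suc k + (\<Sum>i\<in>I. \<Sum>j\<in>I. L i j)"
  have "L i j \<le> l" if "i \<in> I" "j \<in> I" for i j
  proof -
    have "L i j \<le> (\<Sum>j\<in>I. L i j)"
      using assms(1) that by (simp add: member_le_sum)
    also have "\<dots> \<le> (\<Sum>i\<in>I. \<Sum>j\<in>I. L i j)"
      using assms(1) that member_le_sum[of i I "\<lambda>i. \<Sum>j\<in>I. L i j"] by simp
    finally show ?thesis
      by (simp add: l_def)
  qed
  then have sep: "\<not> agree l (x i) (y j)" if "i \<in> I" "j \<in> I" for i j
    using L[OF that] that by simp
  show thesis
  proof (rule that[OF y(1,2)])
    show "k < l"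
      by (simp add: l_def)
    fix z w i j
    assume "agree_on I l x z" "agree_on I l y w" and ij: "i \<in> I" "j \<in> I"
    then have "agree l (x i) (z i)" "agree l (y j) (w j)"
      by (simp_all add: agree_on_def)
    then show "z i \<noteq> w j"
      using sep[OF ij] by (auto simp: agree_def)
  qed
qed

text \<open>A Cantor scheme: each node is a point of the thick part together with a depth, and the two
  children of a node are centers of boxes without common coordinate values.\<close>

lemma perfect_antichain:
  assumes I: "finite I" and F: "cantor_closed I F" and big: "\<not> thin I F"
  obtains K :: "nat set \<Rightarrow> nat \<Rightarrow> real"
  where "\<And>b. K b \<in> F" "\<And>b b'. b \<noteq> b' \<Longrightarrow> K b ` I \<inter> K b' ` I = {}"
proof -
  have sub: "F \<subseteq> cube I"
    using F by (simp add: cantor_closed_def)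
  define P where "P = (\<lambda>x k y l. y \<in> thick_part I F \<and> agree_on I k x y \<and> k < l \<and>
    (\<forall>z w i j. agree_on I l x z \<longrightarrow> agree_on I l y w \<longrightarrow> i \<in> I \<longrightarrow> j \<in> I \<longrightarrow> z i \<noteq> w j))"
  have "\<exists>y l. P x k y l" if "x \<in> thick_part I F" for x k
    unfolding P_def using thick_part_split[OF I sub that, of k] by metis
  then obtain Y L where YL: "\<And>x k. x \<in> thick_part I F \<Longrightarrow> P x k (Y x k) (L x k)"
    by metis
  have "thick_part I F \<noteq> {}"
    using big thin_minus_thick_part[OF I sub] by force
  then obtain x0 where x0: "x0 \<in> thick_part I F"
    by blast
  \<comment> \<open>The node at stage \<open>n\<close> on branch \<open>b\<close>: membership of
    \<open>n\<close> in \<open>b\<close> decides between moving to \<open>Y\<close> and staying.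
    Both children get the depth \<open>L x k\<close>, so siblings have boxes of equal depth.\<close>
  define N where "N = (\<lambda>b :: nat set. rec_nat (x0, 0)
    (\<lambda>n (x, k). (if n \<in> b then Y x k else x, L x k)))"
  define p where "p = (\<lambda>b n. fst (N b n))"
  define d where "d = (\<lambda>b n. snd (N b n))"
  have N_Suc: "p b (Suc n) = (if n \<in> b then Y (p b n) (d b n) else p b n)"
      "d b (Suc n) = L (p b n) (d b n)" for b n
    by (auto simp: p_def d_def N_def case_prod_beta)
  have N0: "p b 0 = x0" "d b 0 = 0" for b
    by (auto simp: p_def d_def N_def)
  have ker: "p b n \<in> thick_part I F" for b n
    by (induction n) (use x0 YL in \<open>auto simp: N0 N_Suc P_def\<close>)
  have node: "P (p b n) (d b n) (Y (p b n) (d b n)) (d b (Suc n))" for b n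
    using YL[OF ker] by (simp add: N_Suc)
  have agr: "agree_on I (d b n) (p b n) (p b (Suc n))" for b n
    using node[of b n] by (simp add: N_Suc P_def)
  have mono: "strict_mono (d b)" for b
    using node by (simp add: strict_mono_Suc_iff P_def)
  have lim: "\<exists>x. \<forall>n. agree (d b n) (p b n i) x" if "i \<in> I" for b i
    using agree_limit[of "d b" "\<lambda>n. p b n i"] agr that mono unfolding agree_on_def by metis
  define X where "X = (\<lambda>b i. SOME x. \<forall>n. agree (d b n) (p b n i) x)"
  have X: "agree (d b n) (p b n i) (X b i)" if "i \<in> I" for b i n
    using someI_ex[OF lim[OF that]] by (simp add: X_def)
  define K where "K = (\<lambda>b. restrict (X b) I)"
  have K: "agree_on I (d b n) (p b n) (K b)" for b n
    using X by (simp add: agree_on_def K_def)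
  show thesis
  proof (rule that)
    fix b
    \<comment> \<open>The nodes \<open>p b k\<close> lie in \<open>F\<close> and agree with
      \<open>K b\<close> to depth \<open>d b k\<close>, which is at least \<open>k\<close>;
      closedness then puts the limit into \<open>F\<close>.\<close>
    have "\<exists>y\<in>F. agree_on I k (K b) y" for k
    proof
      show "p b k \<in> F"
        using ker by (simp add: thick_part_def)
      show "agree_on I k (K b) (p b k)"
        by (rule agree_on_sym[OF agree_on_mono[OF K]]) (rule strict_mono_imp_increasing[OF mono])
    qed
    moreover have "K b \<in> cube I"
      by (simp add: K_def)
    ultimately show "K b \<in> F"
      using F by (simp add: cantor_closed_def)
  next
    fix b b' :: "nat set" assume "b \<noteq> b'"
    \<comment> \<open>The first place where the branches part: up to stage \<open>n\<close> their
      nodes coincide, and the next nodes are siblings with separated boxes.\<close>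
    define n where "n = (LEAST n. n \<in> b \<longleftrightarrow> n \<notin> b')"
    have n: "n \<in> b \<longleftrightarrow> n \<notin> b'"
      unfolding n_def by (rule LeastI_ex) (use \<open>b \<noteq> b'\<close> in blast)
    have "p b m = p b' m \<and> d b m = d b' m" if "m \<le> n" for m
      using that
    proof (induction m)
      case (Suc m)
      then have "m \<in> b \<longleftrightarrow> m \<in> b'"
        using not_less_Least[of m "\<lambda>n. n \<in> b \<longleftrightarrow> n \<notin> b'"] unfolding n_def by auto
      with Suc show ?case
        by (simp add: N_Suc)
    qed (simp add: N0)
    then have same: "p b n = p b' n" "d b n = d b' n"
      by auto
    have sep: "z i \<noteq> w j"
      if "agree_on I (d b (Suc n)) (p b n) z"
        "agree_on I (d b (Suc n)) (Y (p b n) (d b n)) w" "i \<in> I" "j \<in> I" for z w i j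
      using node[of b n] that unfolding P_def by blast
    have "d b' (Suc n) = d b (Suc n)"
      using same by (simp add: N_Suc)
    then show "K b ` I \<inter> K b' ` I = {}"
      using K[of b "Suc n"] K[of b' "Suc n"] n same sep[of "K b" "K b'"] sep[of "K b'" "K b"]
      by (cases "n \<in> b") (auto simp: N_Suc, metis+)
  qed
qed

section \<open>A Bernstein-type rank function\<close>

text \<open>Since there are only countably many boxes, there are at most continuum many codes.\<close>

definition closed_set_code ::
    "nat \<times> nat set \<times> (nat \<Rightarrow> real) set \<Rightarrow> (nat \<times> nat set \<times> (nat \<Rightarrow> real) set) set"
  where "closed_set_code = (\<lambda>(m, I, F). {(m, I, cyl_box I k x) | k x. x \<in> F})"

text \<open>A closed set is determined by the boxes it meets, and nonemptiness lets \<open>m\<close>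
  and \<open>I\<close> be read off the code. The codes are subsets of one countable set.\<close>

lemma closed_sets_lepoll:
  "{(m :: nat, I, F). finite I \<and> cantor_closed I F \<and> F \<noteq> {}} \<lesssim> (UNIV :: nat set set)"
  (is "?T \<lesssim> _")
proof -
  let ?A = "(UNIV :: nat set) \<times> Sigma {I. finite I} (\<lambda>I. \<Union>k. range (cyl_box I k))"
  have "countable {I :: nat set. finite I}"
    by (rule countable_Collect_finite)
  then have A: "countable ?A"
  proof (intro countable_SIGMA)
    show "countable (\<Union>k. range (cyl_box I k))" if "I \<in> {I. finite I}" for I
      using that by (intro countable_boxes) simp
  qed simp_all
  have "inj_on closed_set_code ?T"
  proof (rule inj_onI)
    fix s t assume sT: "s \<in> ?T" and tT: "t \<in> ?T" and eq: "closed_set_code s = closed_set_code t"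
    obtain m I F m' I' F' where st: "s = (m, I, F)" "t = (m', I', F')"
      by (cases s, cases t)
    have F: "cantor_closed I F" "F \<noteq> {}" and F': "cantor_closed I' F'" "F' \<noteq> {}"
      using sT tT by (simp_all add: st)
    obtain x where "x \<in> F"
      using F by blast
    then have "(m, I, cyl_box I 0 x) \<in> closed_set_code s"
      by (auto simp: st closed_set_code_def)
    then have "(m, I, cyl_box I 0 x) \<in> closed_set_code t"
      by (simp only: eq)
    then have mI: "m' = m" "I' = I"
      by (auto simp: st closed_set_code_def)
    have sub: "G \<subseteq> G'" if G: "cantor_closed I G" "cantor_closed I G'"
        "closed_set_code (m, I, G) = closed_set_code (m, I, G')"
      for G G'
    proof
      fix x assume x: "x \<in> G"
      have xc: "x \<in> cube I"
        using G x by (auto simp: cantor_closed_def)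
      have "\<exists>y\<in>G'. agree_on I k x y" for k
      proof -
        have "(m, I, cyl_box I k x) \<in> closed_set_code (m, I, G)"
          using x by (auto simp: closed_set_code_def)
        then have "(m, I, cyl_box I k x) \<in> closed_set_code (m, I, G')"
          by (simp only: G(3))
        then obtain l y where y: "y \<in> G'" "cyl_box I k x = cyl_box I l y"
          by (auto simp: closed_set_code_def)
        have "y \<in> cyl_box I l y"
          using y(1) G(2) by (auto simp: cyl_box_def cantor_closed_def)
        then have "y \<in> cyl_box I k x"
          by (simp only: y(2))
        then show ?thesis
          using y(1) by (auto simp: cyl_box_def)
      qed
      then show "x \<in> G'"
        using G(2) xc by (simp add: cantor_closed_def)
    qed
    show "s = t"
      using sub[OF F(1) F'(1)[unfolded mI]] sub[OF F'(1)[unfolded mI] F(1)] eq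
      by (simp add: st mI)
  qed
  moreover have "closed_set_code ` ?T \<subseteq> Pow ?A"
    by (auto simp: closed_set_code_def)
  ultimately have "?T \<lesssim> Pow ?A"
    unfolding lepoll_def by (intro exI[of _ closed_set_code] conjI)
  also have "Pow ?A \<lesssim> (UNIV :: nat set set)"
  proof -
    have "inj_on ((`) (to_nat_on ?A)) (Pow ?A)"
      by (rule inj_on_image_Pow[OF inj_on_to_nat_on[OF A]])
    then show ?thesis
      unfolding lepoll_def by (intro exI[of _ "(`) (to_nat_on ?A)"] conjI) simp_all
  qed
  finally show ?thesis .
qed

text \<open>The rank classes partition the line into countably many Bernstein-like sets: in one
  coordinate, each class meets every uncountable closed set. In several coordinates a single point
  must have all its coordinates in the same class.\<close>

definition bernstein_rank :: "(real \<Rightarrow> nat) \<Rightarrow> bool"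
  where "bernstein_rank r \<longleftrightarrow> (\<forall>n I F. finite I \<longrightarrow> cantor_closed I F \<longrightarrow> \<not> thin I F \<longrightarrow>
    (\<exists>x\<in>F. \<forall>i\<in>I. r (x i) = n))"

text \<open>Each big closed set offers continuum many points with disjoint sets of coordinate
  values. Selecting one for every task so that different tasks share no value makes the requested
  ranks consistent.\<close>

lemma bernstein_rank_exists:
  obtains r where "bernstein_rank r"
proof -
  \<comment> \<open>The tag \<open>m\<close> makes each closed set a separate task for every
    rank.\<close>
  define T where "T = {(m :: nat, I, F). finite I \<and> cantor_closed I F \<and> \<not> thin I F}"
  define Q where "Q = (\<lambda>I F (K :: nat set \<Rightarrow> nat \<Rightarrow> real). (\<forall>b. K b \<in> F) \<and>
      (\<forall>b b'. b \<noteq> b' \<longrightarrow> K b ` I \<inter> K b' ` I = {}))"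
  define K where "K = (\<lambda>I F. SOME K. Q I F K)"
  have Q: "Q I F (K I F)" if "(m, I, F) \<in> T" for m I F
  proof -
    have "finite I" "cantor_closed I F" "\<not> thin I F"
      using that by (auto simp: T_def)
    then have "\<exists>K. Q I F K"
    proof (rule perfect_antichain)
      fix K' :: "nat set \<Rightarrow> nat \<Rightarrow> real"
      assume "\<And>b. K' b \<in> F" "\<And>b b'. b \<noteq> b' \<Longrightarrow> K' b ` I \<inter> K' b' ` I = {}"
      then have "Q I F K'"
        by (simp add: Q_def)
      then show "\<exists>K. Q I F K"
        by blast
    qed
    then show ?thesis
      unfolding K_def by (rule someI_ex)
  qed
  define S where "S = (\<lambda>(m :: nat, I, F) b. K I F b ` I)"
  have "infinite (UNIV :: nat set set)"
    by (simp add: Finite_Set.finite_set)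
  moreover have "T \<lesssim> (UNIV :: nat set set)"
  proof (rule lepoll_trans[OF subset_imp_lepoll closed_sets_lepoll])
    show "T \<subseteq> {(m, I, F). finite I \<and> cantor_closed I F \<and> F \<noteq> {}}"
      by (auto simp: T_def thin_def)
  qed
  moreover have "finite (S t b)" if "t \<in> T" for t b
    using that by (auto simp: T_def S_def)
  moreover have "S t b \<inter> S t b' = {}" if "t \<in> T" "b \<noteq> b'" for t b b'
  proof (cases t)
    case (fields m I F)
    then show ?thesis
      using Q[of m I F] that by (simp add: S_def Q_def)
  qed
  ultimately have "\<exists>c. \<forall>s\<in>T. \<forall>t\<in>T. s \<noteq> t \<longrightarrow> S s (c s) \<inter> S t (c t) = {}"
    by (rule disjoint_selection)
  then obtain c where c: "\<forall>s\<in>T. \<forall>t\<in>T. s \<noteq> t \<longrightarrow> S s (c s) \<inter> S t (c t) = {}"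
    by blast
  define R where "R = (\<lambda>a m. \<exists>I F. (m, I, F) \<in> T \<and> a \<in> S (m, I, F) (c (m, I, F)))"
  have R_unique: "m = n" if mn: "R a m" "R a n" for a m n
  proof (rule ccontr)
    assume "m \<noteq> n"
    obtain I F I' F' where "(m, I, F) \<in> T" "a \<in> S (m, I, F) (c (m, I, F))"
      "(n, I', F') \<in> T" "a \<in> S (n, I', F') (c (n, I', F'))"
      using mn unfolding R_def by blast
    then show False
      using c \<open>m \<noteq> n\<close> by blast
  qed
  \<comment> \<open>Values not claimed by any task receive an arbitrary rank.\<close>
  define rank where "rank = (\<lambda>a. SOME m. R a m)"
  have rank: "rank a = m" if "R a m" for a m
    unfolding rank_def by (rule R_unique[OF someI[of "R a", OF that] that])
  have "bernstein_rank rank"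
    unfolding bernstein_rank_def
  proof (intro allI impI)
    fix n I F
    assume "finite I" "cantor_closed I F" "\<not> thin I F"
    then have t: "(n, I, F) \<in> T"
      by (simp add: T_def)
    let ?x = "K I F (c (n, I, F))"
    have "rank (?x i) = n" if "i \<in> I" for i
    proof (rule rank)
      show "R (?x i) n"
        unfolding R_def using t that by (intro exI[of _ I] exI[of _ F]) (simp add: S_def)
    qed
    moreover have "?x \<in> F"
      using Q[OF t] by (simp add: Q_def)
    ultimately show "\<exists>x\<in>F. \<forall>i\<in>I. rank (x i) = n"
      by blast
  qed
  then show thesis
    by (rule that)
qed

section \<open>Michael-line topologies and their finite products\<close>

definition michael :: "(real \<Rightarrow> nat) \<Rightarrow> nat \<Rightarrow> real topology"
  where "michael r n = topology (\<lambda>U. \<forall>x\<in>U. n \<le> r x \<longrightarrow> (\<exists>k. \<forall>y. agree k x y \<longrightarrow> y \<in> U))"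

lemma openin_michael:
  "openin (michael r n) U \<longleftrightarrow> (\<forall>x\<in>U. n \<le> r x \<longrightarrow> (\<exists>k. \<forall>y. agree k x y \<longrightarrow> y \<in> U))"
proof -
  let ?O = "\<lambda>U. \<forall>x\<in>U. n \<le> r x \<longrightarrow> (\<exists>k. \<forall>y. agree k x y \<longrightarrow> y \<in> U)"
  have "istopology ?O"
    unfolding istopology_def
  proof (intro conjI allI impI)
    fix U V assume UV: "?O U" "?O V"
    show "?O (U \<inter> V)"
    proof (intro ballI impI)
      fix x assume x: "x \<in> U \<inter> V" "n \<le> r x"
      obtain k where k: "\<And>y. agree k x y \<Longrightarrow> y \<in> U"
        using UV(1) x by blast
      obtain l where l: "\<And>y. agree l x y \<Longrightarrow> y \<in> V"
        using UV(2) x by blast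
      have "y \<in> U \<inter> V" if "agree (max k l) x y" for y
        using k[of y] l[of y] agree_mono[OF that, of k] agree_mono[OF that, of l] by simp
      then show "\<exists>k. \<forall>y. agree k x y \<longrightarrow> y \<in> U \<inter> V"
        by blast
    qed
  next
    fix \<K> assume \<K>: "\<forall>K\<in>\<K>. ?O K"
    show "?O (\<Union>\<K>)"
    proof (intro ballI impI)
      fix x assume x: "x \<in> \<Union>\<K>" "n \<le> r x"
      then obtain K where K: "K \<in> \<K>" "x \<in> K"
        by blast
      then obtain k where "\<forall>y. agree k x y \<longrightarrow> y \<in> K"
        using \<K> x(2) by blast
      then show "\<exists>k. \<forall>y. agree k x y \<longrightarrow> y \<in> \<Union>\<K>"
        using K(1) by blast
    qed
  qed
  then show ?thesis
    by (simp add: michael_def topology_inverse')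
qed

lemma topspace_michael [simp]: "topspace (michael r n) = UNIV"
proof -
  have "openin (michael r n) UNIV"
    by (simp add: openin_michael)
  then show ?thesis
    by (simp add: openin_subset top.extremum_uniqueI)
qed

lemma openin_cylinder: "openin (michael r n) {y. agree k x y}"
  unfolding openin_michael
proof (intro ballI impI exI allI)
  fix y z assume "y \<in> {y. agree k x y}" "agree k y z"
  then show "z \<in> {y. agree k x y}"
    by (simp add: agree_def)
qed

lemma openin_isolated: "r t < n \<Longrightarrow> openin (michael r n) {t}"
  by (simp add: openin_michael)

text \<open>A larger index isolates more points, so the topology only gets finer.\<close>

lemma continuous_map_michael:
  assumes "m \<le> n"
  shows "continuous_map (michael r n) (michael r m) (\<lambda>x. x)"
proof -
  have "openin (michael r n) U" if U: "openin (michael r m) U" for U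
    unfolding openin_michael
  proof (intro ballI impI)
    fix x assume "x \<in> U" "n \<le> r x"
    then show "\<exists>k. \<forall>y. agree k x y \<longrightarrow> y \<in> U"
      using U assms by (simp add: openin_michael)
  qed
  then show ?thesis
    by (simp add: continuous_map)
qed

text \<open>Inserting the constant \<open>c\<close> at \<open>i\<close> maps the product without
  factor \<open>i\<close> continuously onto the slice.\<close>

lemma Lindelof_slice:
  assumes i: "i \<in> I" and L: "Lindelof_space (product_topology X (I - {i}))"
    and c: "c \<in> topspace (X i)"
  shows "Lindelof_space (subtopology (product_topology X I)
    {x \<in> topspace (product_topology X I). x i = c})"
    (is "Lindelof_space (subtopology ?P ?S)")
proof (rule Lindelof_space_continuous_map_image[OF L])
  let ?Q = "product_topology X (I - {i})"
  let ?h = "\<lambda>x. x(i := c)"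
  have "continuous_map ?Q (X k) (\<lambda>x. ?h x k)" if "k \<in> I" for k
  proof (cases "k = i")
    case True
    then show ?thesis
      using c by simp
  next
    case False
    with that have "continuous_map ?Q (X k) (\<lambda>x. x k)"
      by (intro continuous_map_product_projection) simp
    with False show ?thesis
      by simp
  qed
  moreover have "?h x \<in> extensional I" if "x \<in> topspace ?Q" for x
    using that i by (auto simp: extensional_def PiE_def)
  ultimately have h: "continuous_map ?Q ?P ?h"
    by (auto simp: continuous_map_componentwise)
  have im: "?h ` topspace ?Q = ?S"
  proof
    have "?h x \<in> topspace ?P" if "x \<in> topspace ?Q" for x
      using h that by (auto simp: continuous_map_def)
    then show "?h ` topspace ?Q \<subseteq> ?S"
      by auto
    show "?S \<subseteq> ?h ` topspace ?Q"
    proof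
      fix x assume x: "x \<in> ?S"
      have mem: "restrict x (I - {i}) \<in> topspace ?Q"
        using x by (auto simp: PiE_def Pi_def)
      have "x = ?h (restrict x (I - {i}))"
        using x by (auto simp: PiE_def extensional_def restrict_def fun_eq_iff)
      then show "x \<in> ?h ` topspace ?Q"
        using mem by (rule image_eqI)
    qed
  qed
  have sub: "topspace (subtopology ?P ?S) = ?S"
    by auto
  show "continuous_map ?Q (subtopology ?P ?S) ?h"
    using h im by (auto simp: continuous_map_in_subtopology)
  show "?h ` topspace ?Q = topspace (subtopology ?P ?S)"
    by (simp only: im sub)
qed

text \<open>Induction over proper subsets: the cover is reduced to countably many boxes and
  countably many slices \<open>x i = c\<close>, and each slice is handled by the power over
  \<open>I - {i}\<close>.\<close>

lemma Lindelof_power: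
  fixes I :: "nat set"
  assumes r: "bernstein_rank r" and I: "finite I"
  shows "Lindelof_space (product_topology (\<lambda>_. michael r n) I)"
  using I
proof (induction I rule: finite_psubset_induct)
  case (psubset I)
  let ?P = "product_topology (\<lambda>_. michael r n) I"
  show ?case
    unfolding Lindelof_space_alt
  proof (intro allI impI)
    fix \<U> assume \<U>: "(\<forall>U\<in>\<U>. openin ?P U) \<and> topspace ?P \<subseteq> \<Union>\<U>"
    define \<B> where "\<B> = {b \<in> (\<Union>k. range (cyl_box I k)). \<exists>U\<in>\<U>. b \<subseteq> U}"
    have \<B>: "countable \<B>"
      unfolding \<B>_def by (rule countable_subset[OF _ countable_boxes[OF psubset.hyps]]) blast
    have "\<forall>b\<in>\<B>. \<exists>U. U \<in> \<U> \<and> b \<subseteq> U"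
      by (auto simp: \<B>_def)
    then obtain sel where sel: "\<forall>b\<in>\<B>. sel b \<in> \<U> \<and> b \<subseteq> sel b"
      by (rule bchoice[THEN exE])
    define F where "F = cube I - \<Union>\<B>"
    have closed: "cantor_closed I F"
      unfolding cantor_closed_def
    proof (intro conjI ballI impI)
      fix x assume x: "x \<in> cube I" and near: "\<forall>k. \<exists>y\<in>F. agree_on I k x y"
      have "x \<notin> b" if b: "b \<in> \<B>" for b
      proof
        assume "x \<in> b"
        obtain k z where kz: "b = cyl_box I k z"
          using b by (auto simp: \<B>_def)
        obtain y where y: "y \<in> F" "agree_on I k x y"
          using near by blast
        have "y \<in> b"
          using \<open>x \<in> b\<close> y by (auto simp: kz cyl_box_def F_def agree_on_def agree_def)
        then show False
          using y(1) b by (auto simp: F_def)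
      qed
      then show "x \<in> F"
        using x by (auto simp: F_def)
    qed (auto simp: F_def)
    \<comment> \<open>Coordinates of rank exactly \<open>n\<close> are not isolated by definition of
      \<open>michael r n\<close>: an open set around such a point contains a whole box, which
      therefore belongs to \<open>\<B>\<close>.\<close>
    have none: "\<not> (\<exists>x\<in>F. \<forall>i\<in>I. r (x i) = n)"
    proof
      assume "\<exists>x\<in>F. \<forall>i\<in>I. r (x i) = n"
      then obtain x where x: "x \<in> F" "\<And>i. i \<in> I \<Longrightarrow> r (x i) = n"
        by blast
      then have xc: "x \<in> cube I"
        by (simp add: F_def)
      then have "x \<in> \<Union>\<U>"
        using \<U> by (intro subsetD[of "topspace ?P" "\<Union>\<U>"]) simp_all
      then obtain U where U: "U \<in> \<U>" "x \<in> U"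
        by blast
      then have "openin ?P U"
        using \<U> by blast
      then have "\<exists>V. finite {i \<in> I. V i \<noteq> topspace (michael r n)} \<and>
          (\<forall>i\<in>I. openin (michael r n) (V i)) \<and> x \<in> PiE I V \<and> PiE I V \<subseteq> U"
        using U(2) unfolding openin_product_topology_alt by (rule bspec)
      then obtain V where V: "\<And>i. i \<in> I \<Longrightarrow> openin (michael r n) (V i)"
          "x \<in> PiE I V" "PiE I V \<subseteq> U"
        by blast
      have "\<forall>i\<in>I. \<exists>k. \<forall>y. agree k (x i) y \<longrightarrow> y \<in> V i"
      proof
        fix i assume i: "i \<in> I"
        then have "x i \<in> V i"
          by (rule PiE_mem[OF V(2)])
        then show "\<exists>k. \<forall>y. agree k (x i) y \<longrightarrow> y \<in> V i"
          using V(1)[OF i] x(2)[OF i] by (simp add: openin_michael)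
      qed
      then obtain k where k: "\<forall>i\<in>I. \<forall>y. agree (k i) (x i) y \<longrightarrow> y \<in> V i"
        by (rule bchoice[THEN exE])
      define l where "l = sum k I"
      have kl: "k i \<le> l" if "i \<in> I" for i
        unfolding l_def using that psubset.hyps by (intro member_le_sum) simp_all
      have "cyl_box I l x \<subseteq> PiE I V"
      proof
        fix y assume y: "y \<in> cyl_box I l x"
        have "y i \<in> V i" if i: "i \<in> I" for i
        proof -
          have "agree l (x i) (y i)"
            using y i by (simp add: cyl_box_def agree_on_def)
          then have "agree (k i) (x i) (y i)"
            by (rule agree_mono[OF _ kl[OF i]])
          then show ?thesis
            using k i by blast
        qed
        moreover have "y \<in> extensional I"
          using y by (simp add: cyl_box_def PiE_def)
        ultimately show "y \<in> PiE I V"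
          by (simp add: PiE_def)
      qed
      then have "cyl_box I l x \<subseteq> U"
        using V(3) by (rule subset_trans)
      then have "cyl_box I l x \<in> \<B>"
        using U(1) by (auto simp: \<B>_def)
      moreover have "x \<in> cyl_box I l x"
        using xc by (simp add: cyl_box_def)
      ultimately show False
        using x(1) by (auto simp: F_def)
    qed
    have "thin I F"
    proof (rule ccontr)
      assume "\<not> thin I F"
      with r psubset.hyps closed have "\<exists>x\<in>F. \<forall>i\<in>I. r (x i) = n"
        unfolding bernstein_rank_def by (elim allE impE)
      with none show False ..
    qed
    then obtain C where C: "countable C" "\<forall>x\<in>F. \<exists>i\<in>I. x i \<in> C"
      unfolding thin_def by blast
    define S where "S = (\<lambda>(i, c). {x \<in> topspace ?P. x i = c})"
    have "\<forall>p\<in>I \<times> C. \<exists>\<V>. countable \<V> \<and> \<V> \<subseteq> \<U> \<and> S p \<subseteq> \<Union>\<V>"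
    proof
      fix p assume p: "p \<in> I \<times> C"
      obtain i c where ic: "p = (i, c)"
        by (cases p)
      have iI: "i \<in> I"
        using p by (simp add: ic)
      have L: "Lindelof_space (product_topology (\<lambda>_. michael r n) (I - {i}))"
        by (rule psubset.IH) (use iI in blast)
      have "Lindelof_space (subtopology ?P (S p))"
        using Lindelof_slice[OF iI L] by (simp add: S_def ic)
      moreover have SP: "S p \<subseteq> topspace ?P"
        by (auto simp: S_def ic)
      moreover have "S p \<subseteq> \<Union>\<U>"
        by (rule subset_trans[OF SP]) (simp only: \<U>)
      ultimately show "\<exists>\<V>. countable \<V> \<and> \<V> \<subseteq> \<U> \<and> S p \<subseteq> \<Union>\<V>"
        using \<U> by (simp add: Lindelof_space_subtopology_subset)
    qed
    then obtain W where W: "\<forall>p\<in>I \<times> C. countable (W p) \<and> W p \<subseteq> \<U> \<and> S p \<subseteq> \<Union>(W p)"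
      by (rule bchoice[THEN exE])
    have W': "countable (W p)" "W p \<subseteq> \<U>" "S p \<subseteq> \<Union>(W p)" if "p \<in> I \<times> C" for p
      using bspec[OF W that] by simp_all
    have sel': "sel b \<in> \<U>" "b \<subseteq> sel b" if "b \<in> \<B>" for b
      using bspec[OF sel that] by simp_all
    show "\<exists>\<V>. countable \<V> \<and> \<V> \<subseteq> \<U> \<and> topspace ?P \<subseteq> \<Union>\<V>"
    proof (intro exI conjI)
      have "countable (I \<times> C)"
        using psubset.hyps C(1) by (simp add: countable_finite)
      then show "countable (sel ` \<B> \<union> (\<Union>p\<in>I \<times> C. W p))"
        by (intro countable_Un countable_image countable_UN \<B> W'(1))
      show "sel ` \<B> \<union> (\<Union>p\<in>I \<times> C. W p) \<subseteq> \<U>"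
      proof (intro Un_least UN_least)
        show "sel ` \<B> \<subseteq> \<U>"
          by (rule image_subsetI) (rule sel'(1))
        show "W p \<subseteq> \<U>" if "p \<in> I \<times> C" for p
          by (rule W'(2)[OF that])
      qed
      show "topspace ?P \<subseteq> \<Union>(sel ` \<B> \<union> (\<Union>p\<in>I \<times> C. W p))"
      proof
        fix x assume x: "x \<in> topspace ?P"
        show "x \<in> \<Union>(sel ` \<B> \<union> (\<Union>p\<in>I \<times> C. W p))"
        proof (cases "x \<in> F")
          case True
          then obtain i where i: "i \<in> I" "x i \<in> C"
            using C(2) by blast
          then have p: "(i, x i) \<in> I \<times> C"
            by simp
          have "x \<in> S (i, x i)"
            using x by (simp add: S_def)
          then have "x \<in> \<Union>(W (i, x i))"
            by (rule subsetD[OF W'(3)[OF p]])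
          then show ?thesis
            using p by blast
        next
          case False
          then obtain b where "b \<in> \<B>" "x \<in> b"
            using x by (auto simp: F_def)
          then show ?thesis
            using sel'(2) by blast
        qed
      qed
    qed
  qed
qed

lemma Lindelof_michael:
  assumes "bernstein_rank r"
  shows "Lindelof_space (michael r n)"
proof (rule Lindelof_space_continuous_map_image)
  show "Lindelof_space (product_topology (\<lambda>_. michael r n) {0 :: nat})"
    using assms by (rule Lindelof_power) simp
  show "continuous_map (product_topology (\<lambda>_. michael r n) {0 :: nat}) (michael r n) (\<lambda>x. x 0)"
    by (rule continuous_map_product_projection) simp
  have "c \<in> (\<lambda>x. x 0) ` cube {0 :: nat}" for c
    by (rule image_eqI[where x = "\<lambda>i\<in>{0 :: nat}. c"]) auto
  then have "(\<lambda>x. x 0) ` cube {0 :: nat} = UNIV"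
    by (intro equalityI subset_UNIV subsetI)
  then show "(\<lambda>x. x 0) ` topspace (product_topology (\<lambda>_. michael r n) {0 :: nat}) = topspace (michael r n)"
    by simp
qed

text \<open>All factors have index at most \<open>n\<close>, so the power of
  \<open>michael r n\<close> carries a finer topology on the same points and the identity transfers
  the Lindelof property.\<close>

lemma Lindelof_finite_product:
  assumes "bernstein_rank r"
  shows "Lindelof_space (product_topology (michael r) {1..n})"
proof (rule Lindelof_space_continuous_map_image)
  let ?Q = "product_topology (\<lambda>_. michael r n) {1..n}"
  show "Lindelof_space ?Q"
    using assms by (rule Lindelof_power) simp
  have "continuous_map ?Q (michael r k) (\<lambda>x. x k)" if "k \<in> {1..n}" for k
    using continuous_map_compose[OF continuous_map_product_projection[OF that, of "\<lambda>_. michael r n"]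
        continuous_map_michael[of k n r]] that
    by (simp add: o_def)
  then show "continuous_map ?Q (product_topology (michael r) {1..n}) (\<lambda>x. x)"
    by (auto simp: continuous_map_componentwise PiE_def)
  show "(\<lambda>x. x) ` topspace ?Q = topspace (product_topology (michael r) {1..n})"
    by simp
qed

section \<open>A function of the first Baire class\<close>

lemma openin_agree_box:
  assumes "finite J" "J \<subseteq> I"
  shows "openin (product_topology (michael r) I) {y \<in> cube I. agree_on J k x y}"
proof -
  have "{y \<in> cube I. agree_on J k x y} =
      PiE I (\<lambda>i. if i \<in> J then {z. agree k (x i) z} else UNIV)" (is "_ = PiE I ?S")
    using assms(2) by (auto simp: agree_on_def PiE_iff extensional_def split: if_splits)
  moreover have "finite {i \<in> I. ?S i \<noteq> topspace (michael r i)}"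
    by (rule finite_subset[OF _ assms(1)]) auto
  moreover have "openin (michael r i) (?S i)" for i
    using openin_cylinder[of r i k "x i"] openin_topspace[of "michael r i"] by simp
  ultimately show ?thesis
    by (simp add: openin_PiE_gen)
qed

text \<open>The agreement condition fails for large \<open>k\<close> near a point off the diagonal. Near a diagonal
  point with value \<open>t\<close> one may fix a coordinate in which \<open>t\<close> is isolated, and then the condition
  forces agreement with \<open>t\<close>; therefore the set is clopen.\<close>

definition tail_set :: "nat \<Rightarrow> (nat \<Rightarrow> real) set"
  where "tail_set j = {x \<in> cube {1..}. \<forall>k. agree_on {1..k} k x (\<lambda>_. x 1) \<longrightarrow>
    (\<forall>i\<in>{j..<k}. even i \<longrightarrow> i \<notin> digits (x 1))}"

text \<open>A diagonal point passes the agreement test for every \<open>k\<close>. Hence the union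
  over \<open>j\<close> traces on the diagonal the set of \<open>t\<close> with finitely many even
  elements.\<close>

lemma tail_set_diagonal:
  "(\<lambda>i\<in>{1..}. t) \<in> tail_set j \<longleftrightarrow> (\<forall>i\<ge>j. even i \<longrightarrow> i \<notin> digits t)"
proof -
  let ?d = "\<lambda>i\<in>{1::nat..}. t"
  have ag: "agree_on {1..k} k ?d (\<lambda>_. ?d 1)" for k
    by (simp add: agree_on_def)
  have "?d \<in> tail_set j \<longleftrightarrow> (\<forall>k. \<forall>i\<in>{j..<k}. even i \<longrightarrow> i \<notin> digits t)"
    using ag by (simp add: tail_set_def)
  also have "\<dots> \<longleftrightarrow> (\<forall>i\<ge>j. even i \<longrightarrow> i \<notin> digits t)"
    by (meson atLeastLessThan_iff lessI)
  finally show ?thesis .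
qed

lemma incseq_tail_set: "incseq tail_set"
  by (rule incseq_SucI) (auto simp: tail_set_def)

lemma openin_tail_set: "openin (seq_product (michael r)) (tail_set j)"
proof (subst openin_subopen, intro ballI)
  let ?P = "seq_product (michael r)"
  fix x assume x: "x \<in> tail_set j"
  then have xc: "x \<in> cube {1..}"
    by (simp add: tail_set_def)
  show "\<exists>T. openin ?P T \<and> x \<in> T \<and> T \<subseteq> tail_set j"
  proof (cases "\<forall>i\<ge>1. x i = x 1")
    case True
    define t where "t = x 1"
    have xt: "x i = t" if "i \<ge> 1" for i
      using True that unfolding t_def by blast
    have tj: "i \<notin> digits t" if "j \<le> i" "even i" for i
    proof -
      have "agree_on {1..Suc i} (Suc i) x (\<lambda>_. x 1)"
        using xt by (simp add: agree_on_def)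
      then have "\<forall>l\<in>{j..<Suc i}. even l \<longrightarrow> l \<notin> digits (x 1)"
        using x unfolding tail_set_def by blast
      then show ?thesis
        using that by (simp add: t_def)
    qed
    \<comment> \<open>The rank of \<open>t\<close> is below \<open>m\<close>, so \<open>t\<close> is
      isolated in factor \<open>m\<close> and \<open>?B\<close> is open.\<close>
    define m where "m = Suc (r t)"
    have m1: "1 \<le> m"
      by (simp add: m_def)
    let ?A = "{y \<in> cube {1..}. agree_on {1..m} m x y}"
    let ?B = "{y \<in> cube {1..}. y m = t}"
    have "openin ?P ?A"
      by (rule openin_agree_box) auto
    moreover have "openin ?P ?B"
    proof -
      have "continuous_map ?P (michael r m) (\<lambda>y. y m)"
        using m1 by (intro continuous_map_product_projection) simp
      moreover have "openin (michael r m) {t}"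
        by (rule openin_isolated) (simp add: m_def)
      ultimately have "openin ?P {y \<in> topspace ?P. y m \<in> {t}}"
        by (rule openin_continuous_map_preimage)
      then show ?thesis
        by simp
    qed
    ultimately have "openin ?P (?A \<inter> ?B)"
      by (rule openin_Int)
    moreover have "x \<in> ?A \<inter> ?B"
      using xc xt[OF m1] by simp
    moreover have "?A \<inter> ?B \<subseteq> tail_set j"
    proof
      fix y assume y: "y \<in> ?A \<inter> ?B"
      have "i \<notin> digits (y 1)"
        if k: "agree_on {1..k} k y (\<lambda>_. y 1)" and i: "i \<in> {j..<k}" "even i" for k i
      proof -
        \<comment> \<open>If \<open>m \<le> k\<close>, the test compares \<open>y 1\<close> with
          \<open>y m = t\<close>; if \<open>k < m\<close>, the box \<open>?A\<close> already gives
          the agreement, as \<open>i < k\<close>.\<close>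
        have "agree (Suc i) t (y 1)"
        proof (cases "m \<le> k")
          case True
          then have "agree k (y m) (y 1)"
            using k m1 by (simp add: agree_on_def)
          then have "agree k t (y 1)"
            using y by simp
          then show ?thesis
            by (rule agree_mono) (use i(1) in simp)
        next
          case False
          have "agree m (x 1) (y 1)"
            using y m1 by (simp add: agree_on_def)
          then have "agree m t (y 1)"
            by (simp only: t_def)
          then show ?thesis
            by (rule agree_mono) (use i(1) False in simp)
        qed
        then show ?thesis
          using tj[of i] i by (simp add: agree_def)
      qed
      then show "y \<in> tail_set j"
        using y by (simp add: tail_set_def)
    qed
    ultimately show ?thesis
      by (intro exI[of _ "?A \<inter> ?B"] conjI)
  next
    case False
    then obtain i0 where i0: "i0 \<ge> 1" "x i0 \<noteq> x 1"
      by blast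
    then obtain k0 where k0: "\<forall>k\<ge>k0. \<not> agree k (x i0) (x 1)"
      using not_agree_eventually[OF i0(2)] by blast
    \<comment> \<open>Large enough for the box to include coordinate \<open>i0\<close> and to reveal
      that it differs from coordinate 1, so the test fails in the box for all
      \<open>k \<ge> K\<close>.\<close>
    define K where "K = max k0 i0"
    let ?A = "{y \<in> cube {1..}. agree_on {1..K} K x y}"
    have K: "1 \<le> K" "i0 \<le> K" "\<not> agree K (x i0) (x 1)"
      using i0(1) k0 by (simp_all add: K_def)
    have "openin ?P ?A"
      by (rule openin_agree_box) auto
    moreover have "x \<in> ?A"
      using xc by simp
    moreover have "?A \<subseteq> tail_set j"
    proof
      fix y assume y: "y \<in> ?A"
      have xy: "agree K (x i) (y i)" if "1 \<le> i" "i \<le> K" for i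
        using y that by (simp add: agree_on_def)
      have "i \<notin> digits (y 1)"
        if k: "agree_on {1..k} k y (\<lambda>_. y 1)" and i: "i \<in> {j..<k}" "even i" for k i
      proof (cases "K \<le> k")
        case True
        then have "agree k (y i0) (y 1)"
          using k i0(1) K(2) by (simp add: agree_on_def)
        then have "agree K (y i0) (y 1)"
          by (rule agree_mono[OF _ True])
        then have "agree K (x i0) (x 1)"
          using xy[OF i0(1) K(2)] xy[of 1] K(1) by (simp add: agree_def)
        with K(3) show ?thesis ..
      next
        case False
        \<comment> \<open>For \<open>k < K\<close> the box transfers the passed test from
          \<open>y\<close> back to \<open>x\<close>, whose membership then excludes the
          digit.\<close>
        have "agree k (x l) (x 1)" if l: "l \<in> {1..k}" for l
        proof -
          have "agree k (y l) (y 1)"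
            using k l by (simp add: agree_on_def)
          then show ?thesis
            using xy[of l] xy[of 1] l False K(1) by (simp add: agree_def)
        qed
        then have "agree_on {1..k} k x (\<lambda>_. x 1)"
          by (simp add: agree_on_def)
        then have "\<forall>i\<in>{j..<k}. even i \<longrightarrow> i \<notin> digits (x 1)"
          using x unfolding tail_set_def by blast
        then have "i \<notin> digits (x 1)"
          using i by blast
        then show ?thesis
          using xy[of 1] K(1) i(1) False by (simp add: agree_def)
      qed
      then show "y \<in> tail_set j"
        using y by (simp add: tail_set_def)
    qed
    ultimately show ?thesis
      by (intro exI[of _ ?A] conjI)
  qed
qed

text \<open>Non-membership is witnessed by one \<open>k\<close> and one digit below
  \<open>k\<close>, hence visible in a box on finitely many coordinates.\<close>

lemma openin_compl_tail_set: "openin (seq_product (michael r)) (cube {1..} - tail_set j)"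
proof (subst openin_subopen, intro ballI)
  let ?P = "seq_product (michael r)"
  fix x assume x: "x \<in> cube {1..} - tail_set j"
  then obtain k i where k: "agree_on {1..k} k x (\<lambda>_. x 1)"
      and i: "i \<in> {j..<k}" "even i" "i \<in> digits (x 1)"
    by (auto simp: tail_set_def)
  let ?A = "{y \<in> cube {1..}. agree_on {1..k} k x y}"
  have "openin ?P ?A"
    by (rule openin_agree_box) auto
  moreover have "x \<in> ?A"
    using x by simp
  moreover have "?A \<subseteq> cube {1..} - tail_set j"
  proof
    fix y assume y: "y \<in> ?A"
    have k1: "1 \<in> {1..k}"
      using i(1) by simp
    have xy: "agree k (x l) (y l)" if "l \<in> {1..k}" for l
      using y that by (simp add: agree_on_def)
    have "agree k (y l) (y 1)" if l: "l \<in> {1..k}" for l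
    proof -
      have "agree k (x l) (x 1)"
        using k l by (simp add: agree_on_def)
      then show ?thesis
        using xy[OF l] xy[OF k1] by (simp add: agree_def)
    qed
    then have "agree_on {1..k} k y (\<lambda>_. y 1)"
      by (simp add: agree_on_def)
    moreover have "i \<in> digits (y 1)"
      using xy[OF k1] i by (simp add: agree_def)
    ultimately have "y \<notin> tail_set j"
      using i(1,2) by (auto simp: tail_set_def)
    then show "y \<in> cube {1..} - tail_set j"
      using y by simp
  qed
  ultimately show "\<exists>T. openin ?P T \<and> x \<in> T \<and> T \<subseteq> cube {1..} - tail_set j"
    by (intro exI[of _ ?A] conjI)
qed

lemma continuous_map_indicator_clopen:
  assumes "openin X S" "openin X (topspace X - S)"
  shows "continuous_map X euclideanreal (indicator S)"
  unfolding continuous_map_def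
proof (intro conjI allI impI)
  fix U :: "real set"
  have "{x \<in> topspace X. indicator S x \<in> U} =
      (if 1 \<in> U then S else {}) \<union> (if 0 \<in> U then topspace X - S else {})"
    using openin_subset[OF assms(1)] by (auto simp: indicator_def split: if_splits)
  then show "openin X {x \<in> topspace X. indicator S x \<in> U}"
    using assms by auto
qed simp

lemma baire_one_tail_set: "baire_one (seq_product (michael r)) (indicator (\<Union>j. tail_set j))"
  unfolding baire_one_def pointwise_limit_def
proof (intro exI conjI allI ballI)
  fix j
  show "continuous_map (seq_product (michael r)) euclideanreal (indicator (tail_set j))"
    using openin_tail_set[of r j] openin_compl_tail_set[of r j]
    by (intro continuous_map_indicator_clopen) (simp_all del: One_nat_def)
next
  fix x :: "nat \<Rightarrow> real"
  show "(\<lambda>j. indicator (tail_set j) x) \<longlonglongrightarrow> indicator (\<Union>j. tail_set j) x"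
    by (rule LIMSEQ_indicator_incseq[OF incseq_tail_set])
qed

section \<open>Restrictions to the diagonal\<close>

definition cantor_cont :: "(real \<Rightarrow> real) \<Rightarrow> real \<Rightarrow> bool"
  where "cantor_cont F t \<longleftrightarrow> (\<forall>e>0. \<exists>k. \<forall>s. agree k t s \<longrightarrow> \<bar>F s - F t\<bar> < e)"

lemma continuous_map_michael_imp_cantor_cont:
  assumes F: "continuous_map (michael r m) euclideanreal F" and t: "m \<le> r t"
  shows "cantor_cont F t"
  unfolding cantor_cont_def
proof (intro allI impI)
  fix e :: real assume "0 < e"
  have "openin (michael r m) {s \<in> topspace (michael r m). F s \<in> ball (F t) e}"
    by (rule openin_continuous_map_preimage[OF F]) simp
  then have "openin (michael r m) {s. F s \<in> ball (F t) e}"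
    by simp
  moreover have "t \<in> {s. F s \<in> ball (F t) e}"
    using \<open>0 < e\<close> by simp
  ultimately obtain k where k: "\<forall>s. agree k t s \<longrightarrow> s \<in> {s. F s \<in> ball (F t) e}"
    using t unfolding openin_michael by blast
  then show "\<exists>k. \<forall>s. agree k t s \<longrightarrow> \<bar>F s - F t\<bar> < e"
    by (auto simp: dist_real_def abs_minus_commute)
qed

text \<open>Discontinuities are sorted by the size of the oscillation. Each \<open>D q\<close> is
  Cantor closed and has no point of rank \<open>m\<close>, since continuity in
  \<open>michael r m\<close> gives Cantor continuity at ranks from \<open>m\<close> on. So
  \<open>D q\<close> is thin, that is, countable.\<close>

lemma countable_discontinuities:
  assumes r: "bernstein_rank r" and F: "continuous_map (michael r m) euclideanreal F"
  shows "countable {t. \<not> cantor_cont F t}"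
proof -
  define D where "D = (\<lambda>q. {t.
    \<forall>k. \<exists>s s'. agree k t s \<and> agree k t s' \<and> inverse (real (Suc q)) \<le> \<bar>F s - F s'\<bar>})"
  have rank: "r t < m" if t: "t \<in> D q" for t q
  proof (rule ccontr)
    assume "\<not> r t < m"
    then have cont: "cantor_cont F t"
      by (intro continuous_map_michael_imp_cantor_cont[OF F]) simp
    have "0 < inverse (real (Suc q)) / 2"
      by simp
    with cont have "\<exists>k. \<forall>s. agree k t s \<longrightarrow> \<bar>F s - F t\<bar> < inverse (real (Suc q)) / 2"
      unfolding cantor_cont_def by (elim allE impE)
    then obtain k where k: "\<And>s. agree k t s \<Longrightarrow> \<bar>F s - F t\<bar> < inverse (real (Suc q)) / 2"
      by blast
    have "\<exists>s s'. agree k t s \<and> agree k t s' \<and> inverse (real (Suc q)) \<le> \<bar>F s - F s'\<bar>"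
      using t unfolding D_def mem_Collect_eq by (rule spec)
    then obtain s s' where s: "agree k t s" "agree k t s'" "inverse (real (Suc q)) \<le> \<bar>F s - F s'\<bar>"
      by blast
    show False
      using k[OF s(1)] k[OF s(2)] s(3) by linarith
  qed
  have "countable (D q)" for q
  proof -
    \<comment> \<open>A copy of \<open>D q\<close> in the one-coordinate power, to which
      \<open>bernstein_rank\<close> applies.\<close>
    let ?E = "{x \<in> cube {0}. x 0 \<in> D q}"
    have closed: "cantor_closed {0} ?E"
      unfolding cantor_closed_def
    proof (intro conjI ballI impI)
      fix x :: "nat \<Rightarrow> real" assume x: "x \<in> cube {0}" and near: "\<forall>k. \<exists>y\<in>?E. agree_on {0} k x y"
      have "\<exists>s s'. agree k (x 0) s \<and> agree k (x 0) s' \<and> inverse (real (Suc q)) \<le> \<bar>F s - F s'\<bar>" for k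
      proof -
        obtain y where y: "y \<in> ?E" "agree_on {0} k x y"
          by (rule bexE[OF spec[OF near, of k]])
        then have "y 0 \<in> D q"
          by simp
        then have "\<exists>s s'. agree k (y 0) s \<and> agree k (y 0) s' \<and>
            inverse (real (Suc q)) \<le> \<bar>F s - F s'\<bar>"
          unfolding D_def mem_Collect_eq by (rule spec)
        then obtain s s' where s: "agree k (y 0) s" "agree k (y 0) s'"
            "inverse (real (Suc q)) \<le> \<bar>F s - F s'\<bar>"
          by blast
        have xy: "agree k (x 0) (y 0)"
          using y(2) by (simp add: agree_on_def)
        show ?thesis
          using agree_trans[OF xy s(1)] agree_trans[OF xy s(2)] s(3) by blast
      qed
      then show "x \<in> ?E"
        using x by (simp add: D_def)
    qed auto
    have "thin {0} ?E"
    proof (rule ccontr)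
      assume "\<not> thin {0} ?E"
      with r closed have "\<exists>x\<in>?E. \<forall>i\<in>{0}. r (x i) = m"
        unfolding bernstein_rank_def by (elim allE impE) (rule finite.intros | assumption)+
      then obtain x where "x \<in> ?E" "\<forall>i\<in>{0}. r (x i) = m"
        by (rule bexE)
      then show False
        using rank[of "x 0" q] by simp
    qed
    then obtain C where C: "countable C" "\<forall>x\<in>?E. \<exists>i\<in>{0}. x i \<in> C"
      unfolding thin_def by blast
    have "D q \<subseteq> C"
    proof
      fix t assume "t \<in> D q"
      then have "(\<lambda>i\<in>{0 :: nat}. t) \<in> ?E"
        by simp
      then have "\<exists>i\<in>{0 :: nat}. (\<lambda>i\<in>{0 :: nat}. t) i \<in> C"
        by (rule bspec[OF C(2)])
      then show "t \<in> C"
        by simp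
    qed
    then show ?thesis
      using C(1) by (rule countable_subset)
  qed
  then have "countable (\<Union>q. D q)"
    by simp
  moreover have "{t. \<not> cantor_cont F t} \<subseteq> (\<Union>q. D q)"
  proof
    fix t assume "t \<in> {t. \<not> cantor_cont F t}"
    then have "\<not> cantor_cont F t"
      by simp
    then obtain e where e: "e > 0" "\<And>k. \<exists>s. agree k t s \<and> e \<le> \<bar>F s - F t\<bar>"
      unfolding cantor_cont_def not_all not_imp not_ex not_less by blast
    obtain q where q: "inverse (real (Suc q)) < e"
      using reals_Archimedean[OF e(1)] by blast
    have "\<exists>s s'. agree k t s \<and> agree k t s' \<and> inverse (real (Suc q)) \<le> \<bar>F s - F s'\<bar>" for k
    proof -
      obtain s where "agree k t s" "e \<le> \<bar>F s - F t\<bar>"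
        using e(2) by blast
      then have "agree k t s \<and> agree k t t \<and> inverse (real (Suc q)) \<le> \<bar>F s - F t\<bar>"
        using q by simp
      then show ?thesis
        by blast
    qed
    then have "t \<in> D q"
      by (simp add: D_def)
    then show "t \<in> (\<Union>q. D q)"
      by blast
  qed
  ultimately show ?thesis
    by (rule countable_subset[rotated])
qed

text \<open>Late even digits are free to be prescribed while the odd ones diagonalize against
  \<open>C\<close>. The two values of \<open>b\<close> give points with finitely and with infinitely
  many even elements in every cylinder.\<close>

lemma dense_outside_countable:
  assumes "countable C"
  obtains y where "agree k x y" "y \<notin> C" "\<And>i. k \<le> i \<Longrightarrow> even i \<Longrightarrow> i \<in> digits y \<longleftrightarrow> b"
proof -
  \<comment> \<open>Inserting 0 makes the enumerated set nonempty, so that \<open>c\<close> is onto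
    it even for empty \<open>C\<close>.\<close>
  define c where "c = from_nat_into (insert 0 C)"
  have c: "range c = insert 0 C"
    unfolding c_def by (rule range_from_nat_into) (use assms in auto)
  \<comment> \<open>At the odd position \<open>2 * (n + k) + 1\<close> the index
    \<open>i div 2 - k\<close> equals \<open>n\<close>, so \<open>y\<close> differs from
    \<open>c n\<close> there.\<close>
  obtain y where y: "digits y = {i. if i < k then i \<in> digits x
      else if even i then b else i \<notin> digits (c (i div 2 - k))}"
    by (rule obtain_digits)
  show thesis
  proof (rule that)
    show "agree k x y"
      by (simp add: agree_def y)
    show "y \<notin> C"
    proof
      assume "y \<in> C"
      then have "y \<in> range c"
        by (simp add: c)
      then obtain n where n: "y = c n"
        by blast
      have "2 * (n + k) + 1 \<in> digits y \<longleftrightarrow> 2 * (n + k) + 1 \<notin> digits (c n)"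
        by (simp add: y)
      then show False
        by (simp add: n)
    qed
    show "i \<in> digits y \<longleftrightarrow> b" if "k \<le> i" "even i" for i
      using that by (simp add: y)
  qed
qed

lemma restriction_to_diagonal:
  assumes g: "g \<in> CF (michael r)"
  obtains m where "continuous_map (michael r m) euclideanreal (\<lambda>t. g (\<lambda>i\<in>{1..}. t))"
proof -
  let ?P = "seq_product (michael r)"
  have cg: "continuous_map ?P euclideanreal g"
    using g by (simp add: CF_def)
  obtain m where m: "\<And>x y. x \<in> topspace ?P \<Longrightarrow> y \<in> topspace ?P \<Longrightarrow>
      (\<forall>i\<in>{1..m}. x i = y i) \<Longrightarrow> g x = g y"
    using g unfolding CF_def finitely_determined_def by blast
  \<comment> \<open>Only coordinates up to \<open>m\<close> follow the diagonal: the identity from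
    \<open>michael r m\<close> is known to be continuous just into factors of index at most
    \<open>m\<close>. Beyond \<open>m\<close> a constant keeps \<open>e\<close> continuous and does
    not affect \<open>g\<close>.\<close>
  define e where "e = (\<lambda>t. \<lambda>i\<in>{1..}. if i \<le> m then t else (0 :: real))"
  have "continuous_map (michael r m) (michael r k) (\<lambda>t. e t k)" if "k \<in> {1..}" for k
    using that continuous_map_michael[of k m r] by (cases "k \<le> m") (simp_all add: e_def)
  then have "continuous_map (michael r m) ?P e"
    by (auto simp: continuous_map_componentwise e_def)
  then have "continuous_map (michael r m) euclideanreal (g \<circ> e)"
    using cg by (rule continuous_map_compose)
  moreover have "g (e t) = g (\<lambda>i\<in>{1..}. t)" for t
    by (rule m) (simp_all add: e_def)
  ultimately have "continuous_map (michael r m) euclideanreal (\<lambda>t. g (\<lambda>i\<in>{1..}. t))"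
    by (simp add: o_def)
  then show thesis
    by (rule that)
qed

text \<open>A Baire category argument with explicit nested cylinders: at stage \<open>n\<close> some
  function of index at least \<open>n\<close> is forced near \<open>v n\<close> on a whole cylinder,
  so at the common point the sequence oscillates between 1 and 0.\<close>

lemma not_CF_limit:
  assumes r: "bernstein_rank r" and g: "\<And>n. g n \<in> CF (michael r)"
  shows "\<not> pointwise_limit (seq_product (michael r)) g (indicator (\<Union>j. tail_set j))"
proof
  assume lim: "pointwise_limit (seq_product (michael r)) g (indicator (\<Union>j. tail_set j))"
  define G where "G = (\<lambda>n t. g n (\<lambda>i\<in>{1..}. t))"
  define C where "C = (\<Union>n. {t. \<not> cantor_cont (G n) t})"
  have "countable {t. \<not> cantor_cont (G n) t}" for n
  proof -
    obtain m where "continuous_map (michael r m) euclideanreal (G n)"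
      unfolding G_def using restriction_to_diagonal[OF g] by blast
    with r show ?thesis
      by (rule countable_discontinuities)
  qed
  then have C: "countable C"
    by (simp add: C_def)
  define L where "L = (\<lambda>t. indicator (\<Union>j. tail_set j) (\<lambda>i\<in>{1..}. t) :: real)"
  have G: "(\<lambda>n. G n t) \<longlonglongrightarrow> L t" for t
    using lim by (simp add: pointwise_limit_def G_def L_def)
  have L1: "L t = (if \<exists>j. \<forall>i\<ge>j. even i \<longrightarrow> i \<notin> digits t then 1 else 0)" for t
    by (simp add: L_def indicator_def tail_set_diagonal del: One_nat_def)
  \<comment> \<open>The alternating targets: 1 is reached at points with finitely many even
    elements, 0 at the others.\<close>
  define v where "v = (\<lambda>n :: nat. if even n then 1 else 0 :: real)"
  have step: "\<exists>y l. k < l \<and> agree k x y \<and> (\<exists>N\<ge>n. \<forall>z. agree l y z \<longrightarrow> \<bar>G N z - v n\<bar> < 1/2)"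
    for x k n
  proof -
    obtain y where y: "agree k x y" "y \<notin> C" "\<And>i. k \<le> i \<Longrightarrow> even i \<Longrightarrow> i \<in> digits y \<longleftrightarrow> odd n"
      using dense_outside_countable[OF C, of k x "odd n"] by blast
    have "L y = v n"
    proof (cases "even n")
      case True
      then have "\<forall>i\<ge>k. even i \<longrightarrow> i \<notin> digits y"
        using y(3) by blast
      then show ?thesis
        unfolding L1 v_def using True by auto
    next
      case False
      have "\<exists>i\<ge>j. even i \<and> i \<in> digits y" for j
        using y(3)[of "2 * (j + k)"] False by (intro exI[of _ "2 * (j + k)"]) simp
      then show ?thesis
        unfolding L1 v_def using False by auto
    qed
    then have "(\<lambda>N. G N y) \<longlonglongrightarrow> v n"
      using G[of y] by simp
    then have "\<exists>N0. \<forall>N\<ge>N0. dist (G N y) (v n) < 1/4"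
      by (rule metric_LIMSEQ_D) simp
    then obtain N0 where N0: "\<And>N. N \<ge> N0 \<Longrightarrow> dist (G N y) (v n) < 1/4"
      by blast
    define N where "N = max n N0"
    have N: "n \<le> N" "dist (G N y) (v n) < 1/4"
      using N0[of N] by (simp_all add: N_def)
    have "cantor_cont (G N) y"
      using y(2) by (simp add: C_def)
    then have "\<exists>l. \<forall>z. agree l y z \<longrightarrow> \<bar>G N z - G N y\<bar> < 1/4"
      unfolding cantor_cont_def by (elim allE[of _ "1/4"]) simp
    then obtain l where l: "\<And>z. agree l y z \<Longrightarrow> \<bar>G N z - G N y\<bar> < 1/4"
      by blast
    have "\<bar>G N z - v n\<bar> < 1/2" if z: "agree (max l (Suc k)) y z" for z
    proof -
      have "agree l y z"
        by (rule agree_mono[OF z]) simp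
      then have "\<bar>G N z - G N y\<bar> < 1/4"
        by (rule l)
      moreover have "\<bar>G N y - v n\<bar> < 1/4"
        using N(2) by (simp add: dist_real_def)
      ultimately show ?thesis
        by linarith
    qed
    then have "k < max l (Suc k) \<and> agree k x y \<and>
        (\<exists>N\<ge>n. \<forall>z. agree (max l (Suc k)) y z \<longrightarrow> \<bar>G N z - v n\<bar> < 1/2)"
      using y(1) N(1) by auto
    then show ?thesis
      by blast
  qed
  define Q where "Q = (\<lambda>n (p :: real \<times> nat) q. snd p < snd q \<and> agree (snd p) (fst p) (fst q) \<and>
      (\<exists>N\<ge>n. \<forall>z. agree (snd q) (fst q) z \<longrightarrow> \<bar>G N z - v n\<bar> < 1/2))"
  \<comment> \<open>\<open>True\<close> is a trivial invariant, giving the shape that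
    \<open>dependent_nat_choice\<close> expects.\<close>
  have "\<exists>q. True \<and> Q n p q" for n p
    using step[of "snd p" "fst p" n] by (auto simp: Q_def)
  then have "\<exists>p. \<forall>n. True \<and> Q n (p n) (p (Suc n))"
    by (intro dependent_nat_choice) auto
  then obtain p where p: "\<And>n. Q n (p n) (p (Suc n))"
    by blast
  obtain x where x: "\<And>n. agree (snd (p n)) (fst (p n)) x"
  proof (rule agree_limit[of "\<lambda>n. snd (p n)" "\<lambda>n. fst (p n)"])
    show "agree (snd (p n)) (fst (p n)) (fst (p (Suc n)))" for n
      using p[of n] by (simp add: Q_def)
    show "strict_mono (\<lambda>n. snd (p n))"
      using p by (simp add: strict_mono_Suc_iff Q_def)
  qed blast
  have osc: "\<exists>N\<ge>n. \<bar>G N x - v n\<bar> < 1/2" for n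
    using p[of n] x[of "Suc n"] by (auto simp: Q_def)
  have "\<exists>N0. \<forall>N\<ge>N0. dist (G N x) (L x) < 1/2"
    by (rule metric_LIMSEQ_D[OF G]) simp
  then obtain N0 where N0: "\<And>N. N \<ge> N0 \<Longrightarrow> \<bar>G N x - L x\<bar> < 1/2"
    by (auto simp: dist_real_def)
  \<comment> \<open>The parity of \<open>n\<close> is chosen so that \<open>v n\<close> is the value
    other than \<open>L x\<close>; no number is closer than 1/2 to both.\<close>
  obtain n where n: "n \<ge> N0" "\<bar>v n - L x\<bar> = 1"
  proof (cases "L x = 1")
    case True
    then show thesis
      by (intro that[of "2 * N0 + 1"]) (simp_all add: v_def)
  next
    case False
    then have "L x = 0"
      by (simp add: L1 split: if_splits)
    then show thesis
      by (intro that[of "2 * N0"]) (simp_all add: v_def)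
  qed
  obtain N where N: "N \<ge> n" "\<bar>G N x - v n\<bar> < 1/2"
    using osc by blast
  then show False
    using N0[of N] n by linarith
qed

theorem theorem16:
  shows "\<exists>(X :: nat \<Rightarrow> real topology) (f :: (nat \<Rightarrow> real) \<Rightarrow> real).
    (\<forall>n\<ge>1. Lindelof_space (X n)) \<and>
    baire_one (seq_product X) f \<and>
    (\<forall>n\<ge>1. Lindelof_space (product_topology X {1..n})) \<and>
    \<not> (\<exists>g. (\<forall>n. g n \<in> CF X) \<and> pointwise_limit (seq_product X) g f)"
proof -
  obtain r where r: "bernstein_rank r"
    by (rule bernstein_rank_exists)
  show ?thesis
  proof (intro exI conjI allI impI notI)
    show "Lindelof_space (michael r n)" for n
      using r by (rule Lindelof_michael)
    show "baire_one (seq_product (michael r)) (indicator (\<Union>j. tail_set j))"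
      by (rule baire_one_tail_set)
    show "Lindelof_space (product_topology (michael r) {1..n})" for n
      using r by (rule Lindelof_finite_product)
    assume "\<exists>g. (\<forall>n. g n \<in> CF (michael r)) \<and>
      pointwise_limit (seq_product (michael r)) g (indicator (\<Union>j. tail_set j))"
    then show False
      using not_CF_limit[OF r] by blast
  qed
qed

end
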